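(* Let $A\in\mathbb{Z}^{m\times n}$ with $\operatorname{rank}(A)=m$, $\bm{b}\in\mathbb{Z}^m$, $\bm{c}\in\mathbb{Z}^n$, such that the integer linear program $\max\{\bm{c}^\intercal\bm{x}\mid A\bm{x}=\bm{b},\ \bm{x}\in\mathbb{Z}^n_{\geq0}\}$ is feasible and has an optimal solution, and let $A_{\max}\coloneqq\max_i\|A_i\|_1\geq 1$ be the largest $1$-norm of a column of $A$. Then for any $\alpha'>0$ there is an optimal solution $\bm{v}$ with support size $s=|\operatorname{supp}(\bm{v})|$ satisfying $$s\leq m\cdot\Bigl(\log(A_{\max})+\sqrt{\alpha'(\log(A_{\max})+0.05)}+\alpha'/2+\log\bigl(\sqrt{1/\alpha'}\bigr)+1.03\Bigr).$$
   Context: $\log$ denotes the base-2 logarithm. $\operatorname{supp}(\bm{v})$ is the set of indices of non-zero entries of $\bm{v}$. *)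

theory Defs
  imports "HOL-Analysis.Analysis"
begin

definition ilp_feasible_set :: "int ^ 'n ^ 'm \<Rightarrow> int ^ 'm \<Rightarrow> (int ^ 'n) set" where
  "ilp_feasible_set A b = {x. A *v x = b \<and> (\<forall>j. 0 \<le> x $ j)}"

definition ilp_objective :: "int ^ 'n \<Rightarrow> int ^ 'n \<Rightarrow> int" where
  "ilp_objective c x = (\<Sum>j\<in>UNIV. c $ j * x $ j)"

definition ilp_optimal :: "int ^ 'n ^ 'm \<Rightarrow> int ^ 'm \<Rightarrow> int ^ 'n \<Rightarrow> int ^ 'n \<Rightarrow> bool" where
  "ilp_optimal A b c x \<longleftrightarrow> x \<in> ilp_feasible_set A b \<and>
     (\<forall>y \<in> ilp_feasible_set A b. ilp_objective c y \<le> ilp_objective c x)"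

definition norm1 :: "int ^ 'm \<Rightarrow> int" where
  "norm1 u = (\<Sum>i\<in>UNIV. \<bar>u $ i\<bar>)"

definition A_max :: "int ^ 'n ^ 'm \<Rightarrow> int" where
  "A_max A = Max (range (\<lambda>j. norm1 (column j A)))"

definition supp :: "int ^ 'n \<Rightarrow> 'n set" where
  "supp v = {j. v $ j \<noteq> 0}"

text \<open>
  The library's rank is defined for matrices over a field, so the rank of an integer matrix
  is that of its image over the reals.
\<close>

definition int_rank :: "int ^ 'n ^ 'm \<Rightarrow> nat" where
  "int_rank A = rank (map_matrix real_of_int A)"

end

theory Submission
  imports Defs "HOL-Probability.Distributions"
begin

text \<open>
  In an optimal solution of minimum support, the columns of the support have pairwise distinct
  subset sums: otherwise the difference of two indicator vectors is a kernel direction of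
  objective value zero, along which some positive entry can be driven to zero. The \<open>2 ^ s\<close> subset
  sums are thus distinct lattice points whose mean squared distance from their centre is at most
  \<open>s * A_max\<^sup>2 / 4\<close>. Weighting lattice points by a Gaussian of variance \<open>\<tau>\<^sup>2\<close>, the total weight of the
  subset sums is at least \<open>2 ^ s * exp (- s * A_max\<^sup>2 / (8 * \<tau>\<^sup>2))\<close> by convexity, and that of all of
  the lattice is at most \<open>(sqrt (2 * pi) * \<tau> * exp (1 / (24 * \<tau>\<^sup>2))) ^ m\<close>. Choosing \<open>\<tau>\<close> gives
  the bound on \<open>s\<close>.
\<close>

section \<open>Gaussian sums over the integers\<close>

text \<open>Averaging over \<open>v\<close> with \<open>u\<close> its mean gives Jensen's inequality
  for exp; it is used so once for an integral and once for a finite sum.\<close>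

lemma exp_ge_tangent:
  fixes u v :: real
  shows "exp u * (1 + v - u) \<le> exp v"
proof -
  have "exp u * (1 + (v - u)) \<le> exp u * exp (v - u)"
    by (intro mult_left_mono exp_ge_add_one_self) auto
  also have "\<dots> = exp v"
    by (simp add: exp_diff)
  finally show ?thesis
    by (simp add: algebra_simps)
qed

text \<open>Jensen's inequality on a unit interval: the mean of \<open>(x - \<mu>)\<^sup>2\<close> there is \<open>(k - \<mu>)\<^sup>2 + 1/12\<close>.\<close>
lemma gaussian_le_unit_interval_integral:
  fixes \<tau> \<mu> k :: real
  assumes "\<tau> > 0"
  shows "exp (- (k - \<mu>)\<^sup>2 / (2 * \<tau>\<^sup>2)) * exp (- 1 / (24 * \<tau>\<^sup>2))
    \<le> integral {k - 1/2..k + 1/2} (\<lambda>x. exp (- (x - \<mu>)\<^sup>2 / (2 * \<tau>\<^sup>2)))"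
proof -
  define c where "c = 1 / (2 * \<tau>\<^sup>2)"
  define w where "w = - c * ((k - \<mu>)\<^sup>2 + 1/12)"
  \<comment> \<open>Since \<open>w\<close> is the mean of the exponent over the interval, the
    tangent of exp at \<open>w\<close>, composed with the exponent, integrates to exactly
    \<open>exp w\<close>.\<close>
  let ?g = "\<lambda>x. exp w * (1 + (- c * (x - \<mu>)\<^sup>2) - w)"
  let ?H = "\<lambda>x. x - c * (x - \<mu>) ^ 3 / 3 - w * x"
  let ?G = "\<lambda>x. exp w * ?H x"
  have "(?g has_integral ?G (k + 1/2) - ?G (k - 1/2)) {k - 1/2..k + 1/2}"
    by (intro fundamental_theorem_of_calculus)
      (auto intro!: derivative_eq_intros
        simp: has_real_derivative_iff_has_vector_derivative[symmetric] field_simps power2_eq_square)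
  moreover have "?H (k + 1/2) - ?H (k - 1/2) = 1"
    by (simp add: w_def field_simps power2_eq_square power3_eq_cube)
  then have "?G (k + 1/2) - ?G (k - 1/2) = exp w"
    unfolding right_diff_distrib[symmetric] by simp
  ultimately have 1: "(?g has_integral exp w) {k - 1/2..k + 1/2}"
    by simp
  have 2: "(\<lambda>x. exp (- (x - \<mu>)\<^sup>2 / (2 * \<tau>\<^sup>2))) integrable_on {k - 1/2..k + 1/2}"
    using assms by (intro integrable_continuous_interval continuous_intros) auto
  have "exp w \<le> integral {k - 1/2..k + 1/2} (\<lambda>x. exp (- (x - \<mu>)\<^sup>2 / (2 * \<tau>\<^sup>2)))"
  proof (rule has_integral_le[OF 1 integrable_integral[OF 2]])
    fix x
    show "?g x \<le> exp (- (x - \<mu>)\<^sup>2 / (2 * \<tau>\<^sup>2))"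
      using exp_ge_tangent[of w "- c * (x - \<mu>)\<^sup>2"] by (simp add: c_def)
  qed
  moreover have "exp w = exp (- (k - \<mu>)\<^sup>2 / (2 * \<tau>\<^sup>2)) * exp (- 1 / (24 * \<tau>\<^sup>2))"
    unfolding exp_add[symmetric] w_def c_def using assms by (simp add: divide_simps)
  ultimately show ?thesis
    by simp
qed

text \<open>Unit intervals around distinct integers meet at most in endpoints, so their integrals
  add up to at most the full Gaussian integral. The centre \<open>\<mu>\<close> is arbitrary because
  the centre of the subset sums may be half-integral.\<close>

lemma sum_gaussian_int_le:
  fixes \<tau> \<mu> :: real and K :: "int set"
  assumes "\<tau> > 0" "finite K"
  shows "(\<Sum>k\<in>K. exp (- (of_int k - \<mu>)\<^sup>2 / (2 * \<tau>\<^sup>2)))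
    \<le> sqrt (2 * pi * \<tau>\<^sup>2) * exp (1 / (24 * \<tau>\<^sup>2))"
proof -
  let ?f = "\<lambda>x. exp (- (x - \<mu>)\<^sup>2 / (2 * \<tau>\<^sup>2))"
  let ?I = "\<lambda>k::int. {of_int k - 1/2..of_int k + 1/2 :: real}"
  have f_eq: "?f = (\<lambda>x. sqrt (2 * pi * \<tau>\<^sup>2) * normal_density \<mu> \<tau> x)"
    using assms by (auto simp: normal_density_def fun_eq_iff)
  have "has_bochner_integral lborel (normal_density \<mu> \<tau>) 1"
    using assms by (simp add: has_bochner_integral_iff)
  then have "has_bochner_integral lborel ?f (sqrt (2 * pi * \<tau>\<^sup>2) * 1)"
    unfolding f_eq by (intro has_bochner_integral_mult_right)
  then have full: "(?f has_integral sqrt (2 * pi * \<tau>\<^sup>2)) UNIV"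
    using has_integral_integral_lborel[of ?f] by (auto simp: has_bochner_integral_iff)
  have int: "?f integrable_on ?I k" for k
    using assms by (intro integrable_continuous_interval continuous_intros) auto
  have "pairwise (\<lambda>k k'. negligible (?I k \<inter> ?I k')) K"
  proof (rule pairwiseI)
    fix k k' :: int assume "k \<noteq> k'"
    then have "k + 1 \<le> k' \<or> k' + 1 \<le> k"
      by linarith
    then have "of_int k + (1::real) \<le> of_int k' \<or> of_int k' + (1::real) \<le> of_int k"
      by (metis of_int_1 of_int_add of_int_le_iff)
    then have "?I k \<inter> ?I k' \<subseteq> {of_int k + 1/2, of_int k - 1/2}"
      by auto
    then show "negligible (?I k \<inter> ?I k')"
      by (meson negligible_finite negligible_subset finite.intros)
  qed
  then have union: "(?f has_integral (\<Sum>k\<in>K. integral (?I k) ?f)) (\<Union>(?I ` K))"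
    using int assms by (intro has_integral_UN) (auto simp: integrable_integral)
  have "(\<Sum>k\<in>K. ?f (of_int k)) * exp (- 1 / (24 * \<tau>\<^sup>2)) \<le> (\<Sum>k\<in>K. integral (?I k) ?f)"
    unfolding sum_distrib_right
    by (intro sum_mono gaussian_le_unit_interval_integral assms)
  also have "\<dots> \<le> sqrt (2 * pi * \<tau>\<^sup>2)"
    by (rule has_integral_subset_le[OF _ union full]) auto
  finally show ?thesis
    by (simp add: exp_minus field_simps)
qed

section \<open>Second moment and number of distinct subset sums\<close>

text \<open>For a uniformly random subset the deviation is a sum of independent terms plus or minus
  \<open>a j / 2\<close>, so their variances add up. In the induction the cross terms cancel between
  the subsets with and without \<open>x\<close>.\<close>

lemma sum_Pow_square_deviation:
  fixes a :: "'a \<Rightarrow> real"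
  assumes "finite J"
  shows "(\<Sum>S\<in>Pow J. (sum a S - sum a J / 2)\<^sup>2) = 2 ^ card J / 4 * (\<Sum>j\<in>J. (a j)\<^sup>2)"
  using assms
proof (induction J rule: finite_induct)
  case empty
  then show ?case by simp
next
  case (insert x J)
  let ?q = "\<lambda>S. sum a S - sum a J / 2"
  have disj: "Pow J \<inter> insert x ` Pow J = {}"
    using insert by auto
  have inj: "inj_on (insert x) (Pow J)"
    using insert by (auto simp: inj_on_def)
  have sum_insert: "sum a (insert x S) = a x + sum a S" if "S \<in> Pow J" for S
    using that insert by (subst sum.insert) (auto dest: finite_subset)
  have "(\<Sum>S\<in>Pow (insert x J). (sum a S - sum a (insert x J) / 2)\<^sup>2)
      = (\<Sum>S\<in>Pow J. (?q S - a x / 2)\<^sup>2) + (\<Sum>S\<in>Pow J. (?q S + a x / 2)\<^sup>2)"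
  proof -
    have "(sum a S - sum a (insert x J) / 2)\<^sup>2 = (?q S - a x / 2)\<^sup>2"
      "(sum a (insert x S) - sum a (insert x J) / 2)\<^sup>2 = (?q S + a x / 2)\<^sup>2"
      if "S \<in> Pow J" for S
      using that insert by (simp_all add: sum_insert power2_eq_square field_simps)
    then show ?thesis
      using insert disj inj by (simp add: Pow_insert sum.union_disjoint sum.reindex)
  qed
  also have "\<dots> = (\<Sum>S\<in>Pow J. 2 * (?q S)\<^sup>2 + (a x)\<^sup>2 / 2)"
    unfolding sum.distrib[symmetric]
    by (intro sum.cong refl) (simp add: power2_eq_square field_simps)
  also have "\<dots> = 2 * (2 ^ card J / 4 * (\<Sum>j\<in>J. (a j)\<^sup>2)) + 2 ^ card J * ((a x)\<^sup>2 / 2)"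
    using insert by (simp add: sum.distrib sum_distrib_left[symmetric] card_Pow)
  also have "\<dots> = 2 ^ card (insert x J) / 4 * (\<Sum>j\<in>insert x J. (a j)\<^sup>2)"
    using insert by (simp add: field_simps)
  finally show ?case .
qed

lemma distinct_subset_sums_bound:
  fixes a :: "'a \<Rightarrow> int ^ 'm" and \<tau> :: real
  assumes "finite J" and inj: "inj_on (sum a) (Pow J)" and "\<tau> > 0"
  shows "real (card J) * ln 2 \<le> real_of_int (\<Sum>j\<in>J. \<Sum>i\<in>UNIV. (a j $ i)\<^sup>2) / (8 * \<tau>\<^sup>2)
    + real CARD('m) * (ln (sqrt (2 * pi * \<tau>\<^sup>2)) + 1 / (24 * \<tau>\<^sup>2))"
proof -
  define \<mu> where "\<mu> i = real_of_int (sum a J $ i) / 2" for i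
  define K where "K = (\<Union>i. (\<lambda>S. sum a S $ i) ` Pow J)"
  define f where "f i k = exp (- (real_of_int k - \<mu> i)\<^sup>2 / (2 * \<tau>\<^sup>2))" for i k
  define E where "E S = (\<Sum>i\<in>UNIV. (real_of_int (sum a S $ i) - \<mu> i)\<^sup>2) / (2 * \<tau>\<^sup>2)" for S
  define D where "D = real_of_int (\<Sum>j\<in>J. \<Sum>i\<in>UNIV. (a j $ i)\<^sup>2) / (8 * \<tau>\<^sup>2)"
  define q where "q = sqrt (2 * pi * \<tau>\<^sup>2) * exp (1 / (24 * \<tau>\<^sup>2))"
  have "finite K"
    using assms by (auto simp: K_def)
  have "q > 0"
    using assms by (auto simp: q_def)
  have "sum E (Pow J)
      = (\<Sum>i\<in>UNIV. \<Sum>S\<in>Pow J. (real_of_int (sum a S $ i) - \<mu> i)\<^sup>2) / (2 * \<tau>\<^sup>2)"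
    unfolding E_def sum_divide_distrib[symmetric] by (subst sum.swap) simp
  also have "\<dots> = (\<Sum>i\<in>UNIV. 2 ^ card J / 4 * (\<Sum>j\<in>J. (real_of_int (a j $ i))\<^sup>2)) / (2 * \<tau>\<^sup>2)"
    unfolding \<mu>_def sum_component of_int_sum
    by (simp only: sum_Pow_square_deviation[OF \<open>finite J\<close>])
  also have "\<dots> = 2 ^ card J * D"
  proof -
    have "real_of_int (\<Sum>j\<in>J. \<Sum>i\<in>UNIV. (a j $ i)\<^sup>2)
        = (\<Sum>i\<in>UNIV. \<Sum>j\<in>J. (real_of_int (a j $ i))\<^sup>2)"
      by (subst sum.swap) simp
    then show ?thesis
      by (simp add: D_def sum_distrib_left[symmetric] sum_divide_distrib[symmetric])
  qed
  finally have sum_E: "sum E (Pow J) = 2 ^ card J * D" .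
  \<comment> \<open>By \<open>sum_E\<close>, \<open>D\<close> is the mean of \<open>E\<close>, so
    the linear part of the tangent at \<open>- D\<close> sums to zero.\<close>
  have "2 ^ card J * exp (- D) = (\<Sum>S\<in>Pow J. exp (- D) * (1 + (- E S) - (- D)))"
    using \<open>finite J\<close> sum_E
    by (simp add: sum_distrib_left[symmetric] sum.distrib sum_subtractf sum_negf card_Pow)
  also have "\<dots> \<le> (\<Sum>S\<in>Pow J. exp (- E S))"
    by (intro sum_mono exp_ge_tangent)
  also have "\<dots> = (\<Sum>S\<in>Pow J. \<Prod>i\<in>UNIV. f i (sum a S $ i))"
    by (simp add: f_def E_def exp_sum[symmetric] sum_negf sum_divide_distrib[symmetric])
  \<comment> \<open>Distinctness enters here: no vector is counted twice.\<close>
  also have "\<dots> = (\<Sum>y\<in>(\<lambda>S. ($) (sum a S)) ` Pow J. \<Prod>i\<in>UNIV. f i (y i))"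
  proof -
    have "inj_on (\<lambda>S. ($) (sum a S)) (Pow J)"
      using inj by (auto simp: inj_on_def vec_nth_inject)
    then show ?thesis
      by (simp add: sum.reindex)
  qed
  \<comment> \<open>Passing to the full box with sides \<open>K\<close> only adds positive terms,
    and there the weight factors over the coordinates.\<close>
  also have "\<dots> \<le> (\<Sum>y\<in>PiE UNIV (\<lambda>_. K). \<Prod>i\<in>UNIV. f i (y i))"
    using \<open>finite K\<close> by (intro sum_mono2 finite_PiE) (auto simp: K_def f_def intro!: prod_nonneg)
  also have "\<dots> = (\<Prod>i\<in>UNIV. \<Sum>k\<in>K. f i k)"
    using \<open>finite K\<close> by (simp add: prod_sum_PiE)
  also have "\<dots> \<le> (\<Prod>i\<in>(UNIV :: 'm set). q)"
    unfolding f_def q_def using sum_gaussian_int_le[OF \<open>\<tau> > 0\<close> \<open>finite K\<close>]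
    by (intro prod_mono) (auto intro!: sum_nonneg)
  also have "\<dots> = q ^ CARD('m)"
    by simp
  finally have "ln (2 ^ card J * exp (- D)) \<le> ln (q ^ CARD('m))"
    using \<open>q > 0\<close> by (subst ln_le_cancel_iff) auto
  then have "real (card J) * ln 2 - D \<le> real CARD('m) * ln q"
    using \<open>q > 0\<close> by (simp add: ln_mult ln_realpow)
  moreover have "ln q = ln (sqrt (2 * pi * \<tau>\<^sup>2)) + 1 / (24 * \<tau>\<^sup>2)"
    using \<open>\<tau> > 0\<close> unfolding q_def by (subst ln_mult) auto
  ultimately show ?thesis
    by (simp add: D_def)
qed

section \<open>Optimal solutions of minimum support, and column norms\<close>

lemma exists_optimal_distinct_subset_sums:
  fixes A :: "int ^ 'n ^ 'm" and b :: "int ^ 'm" and c :: "int ^ 'n"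
  assumes "\<exists>x. ilp_optimal A b c x"
  shows "\<exists>v. ilp_optimal A b c v \<and> inj_on (sum (\<lambda>j. column j A)) (Pow (supp v))"
proof -
  obtain v where opt: "ilp_optimal A b c v"
    and least: "\<And>w. ilp_optimal A b c w \<Longrightarrow> card (supp v) \<le> card (supp w)"
    using assms ex_has_least_nat[of "ilp_optimal A b c" _ "\<lambda>v. card (supp v)"] by blast
  have feas: "A *v v = b" "\<And>j. 0 \<le> v $ j"
    using opt by (auto simp: ilp_optimal_def ilp_feasible_set_def)
  have diff_empty: "T - S = {}"
    if S: "S \<subseteq> supp v" and T: "T \<subseteq> supp v"
      and eq: "(\<Sum>j\<in>S. column j A) = (\<Sum>j\<in>T. column j A)" for S T
  proof (rule ccontr)
    assume ne: "T - S \<noteq> {}"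
    \<comment> \<open>Moving along \<open>d\<close> lowers exactly the entries in
      \<open>T - S\<close> and raises exactly those in \<open>S - T\<close>.\<close>
    define d :: "int ^ 'n" where "d = (\<chi> j. of_bool (j \<in> S) - of_bool (j \<in> T))"
    have d_nth: "d $ j = of_bool (j \<in> S) - of_bool (j \<in> T)" for j
      by (simp add: d_def)
    have Ad: "A *v d = 0"
    proof -
      have "A *v d = (\<Sum>j\<in>S. column j A) - (\<Sum>j\<in>T. column j A)"
        by (simp add: vec_eq_iff matrix_vector_mult_def d_nth column_def right_diff_distrib
            sum_subtractf sum_mult_of_bool_eq)
      with eq show ?thesis by simp
    qed
    have A_shift: "A *v (v + k *s d) = b" for k
    proof -
      have "A *v (k *s d) = k *s (A *v d)"
        by (simp add: vec_eq_iff matrix_vector_mult_def sum_distrib_left mult.left_commute)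
      then show ?thesis
        using Ad feas(1) by (simp add: matrix_vector_right_distrib)
    qed
    have obj_shift: "ilp_objective c (v + k *s d) = ilp_objective c v + k * ilp_objective c d" for k
      by (simp add: ilp_objective_def algebra_simps sum.distrib sum_distrib_left)
    have shift_le: "k * ilp_objective c d \<le> 0" if "\<And>j. 0 \<le> v $ j + k * d $ j" for k
    proof -
      have "v + k *s d \<in> ilp_feasible_set A b"
        using that A_shift by (simp add: ilp_feasible_set_def)
      then show ?thesis
        using opt obj_shift[of k] by (force simp: ilp_optimal_def)
    qed
    \<comment> \<open>Integrality makes the support entries at least 1, so \<open>v + d\<close> and
      \<open>v - d\<close> are both feasible; optimality of \<open>v\<close> then forces objective
      value 0 on \<open>d\<close>.\<close>
    have pos: "1 \<le> v $ j" if "j \<in> S \<union> T" for j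
      using that S T feas(2)[of j] by (force simp: supp_def)
    have "0 \<le> v $ j + d $ j \<and> 0 \<le> v $ j - d $ j" for j
      using pos[of j] feas(2)[of j] by (auto simp: d_nth)
    then have cd: "ilp_objective c d = 0"
      using shift_le[of 1] shift_le[of "-1"] by simp
    \<comment> \<open>The longest step along \<open>d\<close> that keeps all entries nonnegative. It
      empties position \<open>j0\<close>, and no new support appears because \<open>d\<close>
      vanishes outside \<open>supp v\<close>.\<close>
    define k where "k = Min ((\<lambda>j. v $ j) ` (T - S))"
    have "k \<in> (\<lambda>j. v $ j) ` (T - S)"
      unfolding k_def using ne by (intro Min_in) auto
    then obtain j0 where j0: "j0 \<in> T" "j0 \<notin> S" "k = v $ j0"
      by auto
    have k_le: "k \<le> v $ j" if "j \<in> T - S" for j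
      unfolding k_def using that by (intro Min_le) auto
    define w where "w = v + k *s d"
    have w_nth: "w $ j = v $ j + k * d $ j" for j
      by (simp add: w_def)
    have w_nonneg: "0 \<le> w $ j" for j
      using k_le[of j] feas(2)[of j] feas(2)[of j0] j0(3) by (auto simp: w_nth d_nth)
    have "ilp_optimal A b c w"
      using opt A_shift[of k] obj_shift[of k] w_nonneg cd
      by (simp add: ilp_optimal_def ilp_feasible_set_def w_def)
    moreover have "supp w \<subset> supp v"
    proof
      show "supp w \<subseteq> supp v"
        using S T by (auto simp: supp_def w_nth d_nth split: if_splits)
      have "j0 \<in> supp v" "j0 \<notin> supp w"
        using j0 T by (auto simp: supp_def w_nth d_nth)
      then show "supp w \<noteq> supp v" by auto
    qed
    ultimately show False
      using least psubset_card_mono[of "supp v" "supp w"] by (auto simp: not_less[symmetric])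
  qed
  have "inj_on (sum (\<lambda>j. column j A)) (Pow (supp v))"
  proof (rule inj_onI)
    fix S T
    assume "S \<in> Pow (supp v)" "T \<in> Pow (supp v)"
      "(\<Sum>j\<in>S. column j A) = (\<Sum>j\<in>T. column j A)"
    then have "T - S = {}" "S - T = {}"
      using diff_empty[of S T] diff_empty[of T S] by auto
    then show "S = T" by auto
  qed
  with opt show ?thesis by auto
qed

lemma sum_squares_le_A_max:
  fixes A :: "int ^ 'n ^ 'm"
  shows "(\<Sum>i\<in>UNIV. (column j A $ i)\<^sup>2) \<le> (A_max A)\<^sup>2"
proof -
  have "(\<Sum>i\<in>UNIV. (column j A $ i)\<^sup>2) \<le> (norm1 (column j A))\<^sup>2"
  proof -
    have "(\<Sum>i\<in>UNIV. \<bar>column j A $ i\<bar> * \<bar>column j A $ i\<bar>)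
        \<le> (\<Sum>i\<in>UNIV. \<bar>column j A $ i\<bar> * norm1 (column j A))"
      unfolding norm1_def by (intro sum_mono mult_left_mono member_le_sum) auto
    then show ?thesis
      by (simp add: power2_eq_square norm1_def sum_distrib_right)
  qed
  also have "\<dots> \<le> (A_max A)\<^sup>2"
    unfolding A_max_def by (intro power_mono Max_ge) (auto simp: norm1_def intro!: sum_nonneg)
  finally show ?thesis .
qed

section \<open>Numerical estimates\<close>

lemma ln_2_bounds: "0.693 \<le> ln (2::real)" "ln (2::real) \<le> 0.6932"
  using ln_approx_bounds[of 2 4] by (simp_all add: eval_nat_numeral)

lemma ln_5_4_ge: "0.223 \<le> ln (5/4 :: real)"
  using ln_approx_bounds[of "5/4" 2] by (simp add: eval_nat_numeral)

lemma exp_ge_quartic: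
  fixes x :: real
  assumes "0 \<le> x"
  shows "1 + x + x\<^sup>2 / 2 + x ^ 3 / 6 + x ^ 4 / 24 \<le> exp x"
proof -
  obtain t where "exp x = (\<Sum>m<5. x ^ m / fact m) + exp t / fact 5 * x ^ 5"
    using Maclaurin_exp_le[of x 5] by blast
  moreover have "0 \<le> exp t / fact 5 * x ^ 5"
    using assms by simp
  ultimately show ?thesis
    by (simp add: eval_nat_numeral)
qed

text \<open>In \<open>support_ratio_bound\<close> the quadratic dominates \<open>a * R\<close>,
  0.693 is a lower bound of \<open>ln 2\<close>, and the factor 1.0256 leaves room for the excess of
  \<open>exp 1 * (pi / 2)\<close> over \<open>2 powr 2.06\<close>.\<close>

lemma quadratic_lt_exp:
  fixes z :: real
  assumes "0 \<le> z"
  shows "1.0256 * (z\<^sup>2 / 2 + 0.4314 * z + 0.902) < exp (0.693 * z)"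
proof -
  let ?x = "0.693 * z"
  \<comment> \<open>The difference of the two sides is smallest, relative to them, near \<open>z = 1.85\<close>.\<close>
  have "0 \<le> z\<^sup>2 * (z - 1.85)\<^sup>2" "0 \<le> z * (z - 1.85)\<^sup>2"
    using assms by auto
  then have "3.7 * z ^ 3 - 3.4225 * z\<^sup>2 \<le> z ^ 4" "3.7 * z\<^sup>2 - 3.4225 * z \<le> z ^ 3"
    by (simp_all add: power2_eq_square eval_nat_numeral algebra_simps)
  \<comment> \<open>Once the quartic and cubic terms are replaced by these lower bounds, the
    difference of the two sides is a quadratic with minimum near 0.98.\<close>
  moreover have "0 \<le> (z - 0.98)\<^sup>2"
    by simp
  then have "1.96 * z - 0.9604 \<le> z\<^sup>2"
    by (simp add: power2_eq_square algebra_simps)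
  ultimately have "1.0256 * (z\<^sup>2 / 2 + 0.4314 * z + 0.902)
      < 1 + 0.693 * z + 0.240124 * z\<^sup>2 + 0.05546 * z ^ 3 + 0.0096 * z ^ 4"
    using assms by simp
  also have "\<dots> \<le> 1 + ?x + ?x\<^sup>2 / 2 + ?x ^ 3 / 6 + ?x ^ 4 / 24"
  proof -
    have "0.240124 * z\<^sup>2 \<le> 0.693\<^sup>2 / 2 * z\<^sup>2" "0.05546 * z ^ 3 \<le> 0.693 ^ 3 / 6 * z ^ 3"
      "0.0096 * z ^ 4 \<le> 0.693 ^ 4 / 24 * z ^ 4"
      using assms by (intro mult_right_mono; simp add: power_divide)+
    then show ?thesis
      unfolding power_mult_distrib times_divide_eq_left[symmetric] by linarith
  qed
  also have "\<dots> \<le> exp ?x"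
    using assms by (intro exp_ge_quartic) simp
  finally show ?thesis .
qed

text \<open>Equivalent to \<open>a \<le> 2 powr a\<close>. It keeps \<open>R\<close> in
  \<open>support_ratio_bound\<close> above 1.3, hence \<open>1 / (2 * R)\<close> below
  \<open>ln 2\<close>.\<close>

lemma half_minus_half_log_nonneg:
  fixes a :: real
  assumes "0 < a"
  shows "0 \<le> a / 2 - log 2 a / 2"
proof -
  have "a \<le> exp (a * ln 2)"
  proof -
    have "0 \<le> (0.69 * a - 0.9)\<^sup>2" by simp
    then have "a \<le> 1 + 0.69 * a + (0.69 * a)\<^sup>2 / 2"
      using assms by (simp add: power2_eq_square algebra_simps)
    also have "\<dots> \<le> exp (0.69 * a)"
      using assms by (intro exp_lower_Taylor_quadratic) simp
    also have "\<dots> \<le> exp (a * ln 2)"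
      using assms ln_2_bounds by simp
    finally show ?thesis .
  qed
  then have "ln a \<le> a * ln 2"
    using assms by (metis exp_le_cancel_iff exp_ln)
  then show ?thesis
    by (simp add: log_def field_simps)
qed

text \<open>Linearizes the logarithmic term of \<open>a * R\<close>: the left side is concave in
  \<open>a\<close>, hence below its tangents; the coefficients are rounded in the safe
  direction.\<close>

lemma minus_mult_log_le:
  fixes a :: real
  assumes "0 < a"
  shows "- a * log 2 a / 2 \<le> 0.902 - 0.882 * a"
proof -
  let ?l = "ln 2 :: real"
  \<comment> \<open>The tangent of \<open>ln\<close> at \<open>5/4\<close>, close to the \<open>a\<close> for which the final estimate is tightest.\<close>
  have "ln (5 / 4 / a) \<le> 5 / 4 / a - 1"
    using assms by (intro ln_le_minus_one) simp
  moreover have "ln (5 / 4 / a) = ln (5 / 4) - ln a"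
    using assms by (intro ln_divide_pos) simp_all
  ultimately have "a * (ln (5/4) + 1 - 5 / 4 / a) \<le> a * ln a"
    using assms by (intro mult_left_mono) linarith+
  moreover have "a * (ln (5/4) + 1 - 5 / 4 / a) = a * ln (5/4) + a - 5 / 4"
    using assms by (simp add: algebra_simps)
  moreover have "a * (223 / 1000) \<le> a * ln (5/4)"
    using assms ln_5_4_ge by (intro mult_left_mono) simp_all
  ultimately have "1223 / 1000 * a - 5 / 4 \<le> a * ln a"
    by linarith
  then have "1.223 * a - 1.25 \<le> a * ln a"
    by simp
  moreover have "1.25 \<le> 2 * ?l * 0.902"
    using ln_2_bounds by simp
  moreover have "2 * ?l * 0.882 * a \<le> 1.223 * a"
    using ln_2_bounds assms by (intro mult_right_mono) simp_all
  ultimately have "- (a * ln a) \<le> 2 * ?l * (0.902 - 0.882 * a)"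
    by (simp add: algebra_simps)
  then show ?thesis
    by (simp add: log_def field_simps)
qed

section \<open>From the Gaussian estimate to the support size\<close>

text \<open>Here \<open>t\<close> is the support size per row. If \<open>t\<close> exceeded
  \<open>T\<close>, a variance chosen from \<open>T\<close> would bound \<open>T\<close> in terms of
  \<open>ln R\<close>, and the explicit form of \<open>T\<close> contradicts that bound.\<close>

lemma support_ratio_bound:
  fixes A a t :: real
  defines "T \<equiv> log 2 A + sqrt (a * (log 2 A + 0.05)) + a / 2 + log 2 (sqrt (1 / a)) + 1.03"
  assumes "1 \<le> A" "0 < a"
    and bound: "\<And>\<tau>. 0 < \<tau> \<Longrightarrow>
      t * ln 2 \<le> t * A\<^sup>2 / (8 * \<tau>\<^sup>2) + ln (sqrt (2 * pi * \<tau>\<^sup>2)) + 1 / (24 * \<tau>\<^sup>2)"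
  shows "t \<le> T"
proof (rule ccontr)
  assume "\<not> t \<le> T"
  define l :: real where "l = ln 2"
  define u where "u = sqrt (a * (log 2 A + 0.05))"
  \<comment> \<open>The shift 1/3 absorbs the lattice correction: for
    \<open>\<tau>\<^sup>2 = A\<^sup>2 * R / 4\<close> and \<open>A \<ge> 1\<close>, the term
    \<open>1 / (24 * \<tau>\<^sup>2)\<close> is at most \<open>(1/3) / (2 * R)\<close>.\<close>
  define R where "R = T + 1/3"
  \<comment> \<open>Chosen so that \<open>2 * (T - log 2 A) = z - log 2 a + 2.06\<close>.\<close>
  define z where "z = 2 * u + a"
  have l: "0.693 \<le> l" "l \<le> 0.6932"
    using ln_2_bounds by (auto simp: l_def)
  have logA: "0 \<le> log 2 A" "log 2 A * l = ln A"
    using assms by (auto simp: l_def log_def)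
  have u: "0 \<le> u" "u\<^sup>2 = a * (log 2 A + 0.05)"
    using logA assms by (auto simp: u_def)
  have T: "T = log 2 A + u + a / 2 - log 2 a / 2 + 1.03"
    using assms by (simp add: T_def u_def log_def ln_sqrt ln_div)
  have R: "1.3 < R"
    unfolding R_def T using logA u half_minus_half_log_nonneg[OF \<open>0 < a\<close>] by simp
  have z: "0 \<le> z" using u assms by (simp add: z_def)
  have tR: "R < t + 1/3"
    using \<open>\<not> t \<le> T\<close> by (simp add: R_def)

  \<comment> \<open>The upper bound on \<open>t\<close> is nearly optimal for \<open>\<tau>\<^sup>2 = A\<^sup>2 (t + 1/3) / 4\<close>;
    replacing \<open>t + 1/3\<close> by \<open>R\<close> makes it linear in \<open>t\<close>.\<close>
  define \<tau> where "\<tau> = A * sqrt R / 2"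
  have \<tau>: "0 < \<tau>" "\<tau>\<^sup>2 = A\<^sup>2 * R / 4"
    using assms R by (auto simp: \<tau>_def power_mult_distrib power_divide)
  have "t * A\<^sup>2 / (8 * \<tau>\<^sup>2) = t / (2 * R)"
    using assms R by (simp add: \<tau>)
  moreover have "1 / (24 * \<tau>\<^sup>2) \<le> (1/3) / (2 * R)"
  proof -
    have "1 \<le> A\<^sup>2" using assms by simp
    then have "R \<le> A\<^sup>2 * R" using R by simp
    then show ?thesis using R by (simp add: \<tau> divide_simps)
  qed
  moreover have "ln (sqrt (2 * pi * \<tau>\<^sup>2)) = ln (pi / 2) / 2 + ln A + ln R / 2"
    using assms R by (simp add: \<tau> ln_sqrt ln_mult ln_div ln_realpow field_simps)
  ultimately have "t * l \<le> (t + 1/3) / (2 * R) + ln (pi / 2) / 2 + ln A + ln R / 2"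
    using bound[OF \<tau>(1)] by (simp add: l_def add_divide_distrib)
  then have "(t + 1/3) * (l - 1 / (2 * R)) \<le> l / 3 + ln (pi / 2) / 2 + ln A + ln R / 2"
    by (simp add: algebra_simps)
  \<comment> \<open>The factor \<open>l - 1 / (2 * R)\<close> is nonnegative, so
    \<open>t + 1/3\<close> may be lowered to \<open>R\<close>, which eliminates
    \<open>t\<close>.\<close>
  moreover have "R * (l - 1 / (2 * R)) \<le> (t + 1/3) * (l - 1 / (2 * R))"
  proof (intro mult_right_mono)
    have "1 / (2 * R) \<le> 1 / 2.6" using R by (intro divide_left_mono) auto
    then show "0 \<le> l - 1 / (2 * R)" using l by simp
  qed (use tR in simp)
  moreover have "R * (l - 1 / (2 * R)) = T * l + l / 3 - 1 / 2"
    using R by (simp add: R_def field_simps)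
  ultimately have upper: "2 * (T - log 2 A) * l \<le> 1 + ln (pi / 2) + ln R"
    using logA by (simp add: algebra_simps)

  \<comment> \<open>Exponentiated, \<open>upper\<close> says that
    \<open>exp (l * z + 2.06 * l)\<close> is at most \<open>exp 1 * (pi / 2) * (a * R)\<close>. This
    is refuted by comparing \<open>a * R\<close> with \<open>exp (l * z)\<close> and
    \<open>exp 1 * (pi / 2)\<close> with \<open>exp (2.06 * l)\<close>.\<close>
  have "a * R \<le> z\<^sup>2 / 2 + 0.4314 * z + 0.902"
  proof -
    \<comment> \<open>The definition of \<open>u\<close> turns \<open>a * log 2 A\<close> into
      \<open>u\<^sup>2 - 0.05 * a\<close>; thus the 0.05 under the root lowers the coefficient of
      \<open>a\<close>.\<close>
    have "a * R = u\<^sup>2 + a * u + a\<^sup>2 / 2 + (- a * log 2 a / 2) + (1.03 + 1/3 - 0.05) * a"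
      unfolding u(2) by (simp add: R_def T algebra_simps power2_eq_square)
    also have "\<dots> \<le> u\<^sup>2 + a * u + a\<^sup>2 / 2 + (0.902 - 0.882 * a) + 1.3134 * a"
      using minus_mult_log_le[OF \<open>0 < a\<close>] assms by simp
    also have "\<dots> \<le> z\<^sup>2 / 2 + 0.4314 * z + 0.902"
    proof -
      have "0 \<le> u\<^sup>2 + a * u + 0.8628 * u" using u assms by simp
      then show ?thesis by (simp add: z_def power2_eq_square algebra_simps add_divide_distrib)
    qed
    finally show ?thesis .
  qed
  then have "1.0256 * (a * R) < exp (0.693 * z)"
    using quadratic_lt_exp[OF z] by simp
  also have "\<dots> \<le> exp (l * z)"
    unfolding exp_le_cancel_iff using l z by (intro mult_right_mono)
  finally have aR: "1.0256 * (a * R) < exp (l * z)" .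
  have "exp 1 * (pi / 2) \<le> 2.72 * (3.1416 / 2)"
    using e_less_272 pi_approx by (intro mult_mono) auto
  also have "\<dots> \<le> 1.0256 * (4 * (1 + 0.06 * 0.693))"
    by simp
  also have "\<dots> \<le> 1.0256 * (4 * exp (0.06 * l))"
    using l by (intro mult_left_mono order_trans[OF _ exp_ge_add_one_self]) simp_all
  also have "\<dots> = 1.0256 * exp (2.06 * l)"
  proof -
    have "(4::real) = exp (2 * l)"
      unfolding l_def by (simp add: exp_double)
    then have "4 * exp (0.06 * l) = exp (2 * l + 0.06 * l)"
      by (simp only: exp_add)
    also have "2 * l + 0.06 * l = 2.06 * l"
      by simp
    finally show ?thesis by simp
  qed
  finally have const: "exp 1 * (pi / 2) \<le> 1.0256 * exp (2.06 * l)" .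
  have "1.0256 * (exp 1 * (pi / 2) * (a * R)) = (exp 1 * (pi / 2)) * (1.0256 * (a * R))"
    by simp
  also have "\<dots> < (1.0256 * exp (2.06 * l)) * exp (l * z)"
    using const aR R assms by (intro mult_le_less_imp_less) auto
  also have "\<dots> = 1.0256 * exp (l * z + 2.06 * l)"
    by (simp add: exp_add)
  finally have "exp 1 * (pi / 2) * (a * R) < exp (l * z + 2.06 * l)"
    by (rule mult_left_less_imp_less) simp
  moreover have "0 < exp 1 * (pi / 2) * (a * R)"
    using R assms by simp
  ultimately have "ln (exp 1 * (pi / 2) * (a * R)) < l * z + 2.06 * l"
    by (metis exp_ln exp_less_cancel_iff)
  then have "1 + ln (pi / 2) + ln a + ln R < l * z + 2.06 * l"
    using R \<open>0 < a\<close> by (simp add: ln_mult ln_div)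
  moreover have "log 2 a * l = ln a"
    by (simp add: l_def log_def)
  then have "2 * (T - log 2 A) * l = l * z + 2.06 * l - ln a"
    by (simp add: T z_def algebra_simps)
  ultimately show False
    using upper by simp
qed

theorem theorem22:
  fixes A :: "int ^ 'n ^ 'm" and b :: "int ^ 'm" and c :: "int ^ 'n" and \<alpha>' :: real
  assumes rank: "int_rank A = CARD('m)"
    and feasible: "ilp_feasible_set A b \<noteq> {}"
    and optimum: "\<exists>x. ilp_optimal A b c x"
    and A_max_ge_1: "A_max A \<ge> 1"
    and alpha_pos: "\<alpha>' > 0"
  shows "\<exists>v. ilp_optimal A b c v \<and>
    real (card (supp v)) \<le> real CARD('m) *
      (log 2 (real_of_int (A_max A))
       + sqrt (\<alpha>' * (log 2 (real_of_int (A_max A)) + 0.05))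
       + \<alpha>' / 2 + log 2 (sqrt (1 / \<alpha>')) + 1.03)"
proof -
  obtain v where opt: "ilp_optimal A b c v"
    and inj: "inj_on (sum (\<lambda>j. column j A)) (Pow (supp v))"
    using exists_optimal_distinct_subset_sums[OF optimum] by blast
  let ?s = "real (card (supp v))" and ?m = "real CARD('m)" and ?A = "real_of_int (A_max A)"
  let ?T = "log 2 ?A + sqrt (\<alpha>' * (log 2 ?A + 0.05)) + \<alpha>' / 2 + log 2 (sqrt (1 / \<alpha>')) + 1.03"
  have m: "?m > 0" by simp
  \<comment> \<open>Dividing the subset-sum estimate by the number of rows leaves a bound on the
    ratio alone.\<close>
  have "?s / ?m \<le> ?T"
  proof (rule support_ratio_bound)
    show "1 \<le> ?A" "0 < \<alpha>'"
      using A_max_ge_1 alpha_pos by simp_all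
    fix \<tau> :: real
    assume "0 < \<tau>"
    let ?Q = "\<Sum>j\<in>supp v. \<Sum>i\<in>UNIV. (column j A $ i)\<^sup>2"
    let ?g = "ln (sqrt (2 * pi * \<tau>\<^sup>2)) + 1 / (24 * \<tau>\<^sup>2)"
    have "?Q \<le> (\<Sum>j\<in>supp v. (A_max A)\<^sup>2)"
      by (intro sum_mono sum_squares_le_A_max)
    then have "real_of_int ?Q \<le> real_of_int (int (card (supp v)) * (A_max A)\<^sup>2)"
      by (simp only: of_int_le_iff sum_constant of_nat_id)
    then have Q: "real_of_int ?Q \<le> ?s * ?A\<^sup>2"
      by simp
    have "?s * ln 2 \<le> real_of_int ?Q / (8 * \<tau>\<^sup>2) + ?m * ?g"
      by (rule distinct_subset_sums_bound[OF _ inj \<open>0 < \<tau>\<close>]) simp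
    also have "\<dots> \<le> ?s * ?A\<^sup>2 / (8 * \<tau>\<^sup>2) + ?m * ?g"
      using Q by (intro add_right_mono divide_right_mono) auto
    finally have "?s * ln 2 / ?m \<le> (?s * ?A\<^sup>2 / (8 * \<tau>\<^sup>2) + ?m * ?g) / ?m"
      using m by (intro divide_right_mono) auto
    then show "?s / ?m * ln 2 \<le> ?s / ?m * ?A\<^sup>2 / (8 * \<tau>\<^sup>2)
        + ln (sqrt (2 * pi * \<tau>\<^sup>2)) + 1 / (24 * \<tau>\<^sup>2)"
      using m by (simp add: add_divide_distrib mult.commute)
  qed
  then have "?s \<le> ?m * ?T"
    using m by (simp only: pos_divide_le_eq mult.commute[of ?T])
  with opt show ?thesis by blast
qed

end
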